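(* Consider a function $f$ and the kernel function $\mathcal{K}(\mathbf{x},\mathbf{y})=f(\|\mathbf{x}-\mathbf{y}\|_2^2)$ with $\mathbf{x}=(x_1,\ldots,x_d)$ and $\mathbf{y}=(y_1,\ldots,y_d)$, where $x_i\in[0,D/\sqrt d]$ and $y_i\in[0,D/\sqrt d]$ and $D$ is a constant independent of $d$ (so that $\|\mathbf{x}-\mathbf{y}\|_2^2\le D^2$). Suppose that $f$ is analytic in $[0,D^2]$ and is analytically continuable to a transformed Bernstein ellipse (for $[0,D^2]$) with parameter $\rho_D^2>1$, and that $|f(x)|\le C_D$ inside the ellipse. Then, with $n$ fixed, the low-rank kernel approximation of $\mathcal{K}$, for a fixed precision $\epsilon$, is achievable with a rank proportional to $$d^{\frac{-\log c_1\epsilon}{c_2}},$$ where $c_1$ and $c_2$ are positive constants.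
   Context: A low-rank kernel of rank (function rank) at most $R$ is a finite sum of separate products $\sum_{i=1}^{R}g_i(\mathbf{x})h_i(\mathbf{y})$ with $g_i,h_i$ real functions. The low-rank kernel approximation referred to, with $n\ge 0$, is the approximation of $\mathcal{K}$ in the $L_\infty$ norm, $\mathcal{K}(\mathbf{x},\mathbf{y})=\sum_{i=1}^{R}g_i(\mathbf{x})h_i(\mathbf{y})+\epsilon_n$, by a low-rank kernel of function rank at most $R=R(n,d)=\binom{n+d+2}{d+2}$, where $\{g_i\}_{i=1}^R$ and $\{h_i\}_{i=1}^R$ are two sequences of $d$-variable polynomials and $|\epsilon_n|\le\frac{2C_D\rho_D^{-2n}}{\rho_D^2-1}$. The precision $\epsilon$ is the $L_\infty$ error of the approximation. In the exponent, $\log c_1\epsilon$ is the logarithm of the product $c_1\epsilon$. The Bernstein ellipse on $[-1,1]$ with parameter $\rho^2$ is the open region $E_{\rho^2}$ of the complex plane bounded by the ellipse $\{\tfrac12(\rho^2e^{\imath\theta}+\rho^{-2}e^{-\imath\theta}) : \theta\in[0,2\pi)\}$. For an interval $[a,b]$, let $\phi$ be a linear (affine) mapping from $[a,b]$ to $[-1,1]$; the transformed Bernstein ellipse for $[a,b]$ with parameter $\rho^2$ is $\phi^{-1}(E_{\rho^2})$. *)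

theory Defs
  imports "HOL-Analysis.Analysis" "HOL-Library.Landau_Symbols"
begin

definition bernstein_curve :: "real \<Rightarrow> complex set" where
  "bernstein_curve r =
     {(of_real r * cis \<theta> + of_real (inverse r) * cis (- \<theta>)) / 2 | \<theta>. \<theta> \<in> {0..<2 * pi}}"

text \<open>\<^const>\<open>inside\<close> is the union of the bounded components of the complement, so this is the
  open region enclosed by the ellipse.\<close>

definition bernstein_ellipse :: "real \<Rightarrow> complex set" where
  "bernstein_ellipse r = inside (bernstein_curve r)"

text \<open>The affine map below is the orientation-preserving one from \<open>[a,b]\<close> onto \<open>[-1,1]\<close>; the
  orientation-reversing one is its negative and gives the same preimage, since the ellipse is
  symmetric about 0.\<close>

definition transformed_bernstein_ellipse :: "real \<Rightarrow> real \<Rightarrow> real \<Rightarrow> complex set" where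
  "transformed_bernstein_ellipse a b r =
     (\<lambda>z. (2 * z - of_real (a + b)) / of_real (b - a)) -` bernstein_ellipse r"

text \<open>Because \<open>d\<close> tends to infinity in the statement, a point of \<open>\<real>\<^sup>d\<close> is a function
  \<open>nat \<Rightarrow> real\<close> of which only the values at \<open>i < d\<close> matter.\<close>

definition dist_sq :: "nat \<Rightarrow> (nat \<Rightarrow> real) \<Rightarrow> (nat \<Rightarrow> real) \<Rightarrow> real" where
  "dist_sq d x y = (\<Sum>i<d. (x i - y i)\<^sup>2)"

definition cube :: "nat \<Rightarrow> real \<Rightarrow> (nat \<Rightarrow> real) set" where
  "cube d D = {..<d} \<rightarrow>\<^sub>E {0..D / sqrt (real d)}"

text \<open>\<open>A\<close> is a finite set of exponent vectors.\<close>

definition polynomial_in_vars :: "nat \<Rightarrow> ((nat \<Rightarrow> real) \<Rightarrow> real) \<Rightarrow> bool" where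
  "polynomial_in_vars d g \<longleftrightarrow>
     (\<exists>(A :: (nat \<Rightarrow> nat) set) c. finite A \<and>
        (\<forall>x. g x = (\<Sum>\<alpha>\<in>A. c \<alpha> * (\<Prod>i<d. x i ^ \<alpha> i))))"

text \<open>\<open>K\<close> is approximated on \<open>S \<times> S\<close> with \<open>L\<^sub>\<infinity>\<close> error at most \<open>\<epsilon>\<close> by a sum of \<open>R\<close> products of
  \<open>d\<close>-variable polynomials, i.e. by a kernel of function rank at most \<open>R\<close>.\<close>

definition low_rank_approximable ::
  "nat \<Rightarrow> (nat \<Rightarrow> real) set \<Rightarrow> ((nat \<Rightarrow> real) \<Rightarrow> (nat \<Rightarrow> real) \<Rightarrow> real) \<Rightarrow> nat \<Rightarrow> real \<Rightarrow> bool" where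
  "low_rank_approximable d S K R \<epsilon> \<longleftrightarrow>
     (\<exists>g h. (\<forall>i<R. polynomial_in_vars d (g i) \<and> polynomial_in_vars d (h i)) \<and>
        (\<forall>x\<in>S. \<forall>y\<in>S. \<bar>K x y - (\<Sum>i<R. g i x * h i y)\<bar> \<le> \<epsilon>))"

definition rank_bound :: "nat \<Rightarrow> nat \<Rightarrow> nat" where
  "rank_bound n d = (n + d + 2) choose (d + 2)"

definition error_bound :: "real \<Rightarrow> real \<Rightarrow> nat \<Rightarrow> real" where
  "error_bound C \<rho> n = 2 * C * \<rho> powi (- 2 * int n) / (\<rho>\<^sup>2 - 1)"

text \<open>Proportionality is meant asymptotically as \<open>d \<rightarrow> \<infinity>\<close>, with a factor independent of \<open>d\<close>.\<close>

definition proportional_to :: "(nat \<Rightarrow> real) \<Rightarrow> (nat \<Rightarrow> real) \<Rightarrow> bool" where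
  "proportional_to u v \<longleftrightarrow> (\<exists>\<kappa>>0. u \<sim>[at_top] (\<lambda>d. \<kappa> * v d))"

end

theory Submission
  imports Defs "HOL-Complex_Analysis.Complex_Analysis"
begin

text \<open>
  Pulled back along the Joukowski map \<open>w \<mapsto> (w + 1/w) / 2\<close>, Cauchy's formula on an ellipse becomes an
  integral over a circle \<open>norm w = s\<close> whose kernel is a sum of two geometric series in \<open>1/w\<close>.
  Cutting both series after \<open>n\<close> terms leaves the degree-\<open>n\<close> Chebyshev sum of \<open>f\<close> with an explicit
  remainder, bounded by \<open>2 C / (s ^ n (s - 1))\<close>; the coefficients do not depend on \<open>s\<close>, so \<open>s\<close> may
  tend to the parameter of the ellipse. A degree-\<open>n\<close> polynomial of the squared distance, itself a
  sum of \<open>d + 2\<close> separate products, has one separate product for each monomial of degree at most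
  \<open>n\<close> in \<open>d + 2\<close> variables, and their number is asymptotic to \<open>d ^ n / n!\<close>. Since the error decays
  like \<open>\<rho> ^ (- 2 n)\<close>, the exponent \<open>n\<close> is an affine function of \<open>- ln \<epsilon>\<close>.
\<close>

subsection \<open>Polynomial kernels of the squared distance\<close>

text \<open>The definition indexes coefficients by exponent vectors, so each vector may occur once.
  Products and sums produce families in which vectors coincide; grouping the indices along the
  fibres of \<open>e\<close> and adding their coefficients repairs this.\<close>

lemma polynomial_in_varsI:
  assumes "finite I" and g: "\<And>x. g x = (\<Sum>i\<in>I. c i * (\<Prod>j<d. x j ^ e i j))"
  shows "polynomial_in_vars d g"
  unfolding polynomial_in_vars_def
proof (intro exI conjI allI)
  show "finite (e ` I)"
    using assms by simp
  show "g x = (\<Sum>\<alpha>\<in>e ` I. (\<Sum>i | i \<in> I \<and> e i = \<alpha>. c i) * (\<Prod>j<d. x j ^ \<alpha> j))" for x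
  proof -
    have "g x = (\<Sum>\<alpha>\<in>e ` I. \<Sum>i | i \<in> I \<and> e i = \<alpha>. c i * (\<Prod>j<d. x j ^ e i j))"
      unfolding g by (rule sum.image_gen[OF \<open>finite I\<close>])
    also have "\<dots> = (\<Sum>\<alpha>\<in>e ` I. (\<Sum>i | i \<in> I \<and> e i = \<alpha>. c i) * (\<Prod>j<d. x j ^ \<alpha> j))"
      by (auto simp: sum_distrib_right intro!: sum.cong)
    finally show ?thesis .
  qed
qed

section \<open>Closure properties of polynomials in \<open>d\<close> variables\<close>

lemma polynomial_in_vars_const: "polynomial_in_vars d (\<lambda>x. c)"
  by (rule polynomial_in_varsI[where I = "{()}" and c = "\<lambda>_. c" and e = "\<lambda>_ _. 0"]) auto

lemma polynomial_in_vars_var: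
  assumes "i < d"
  shows "polynomial_in_vars d (\<lambda>x. x i)"
proof (rule polynomial_in_varsI[where I = "{()}" and c = "\<lambda>_. 1" and
      e = "\<lambda>_ j. if j = i then 1 else 0"])
  fix x :: "nat \<Rightarrow> real"
  have "(\<Prod>j<d. x j ^ (if j = i then 1 else 0)) = (\<Prod>j<d. if j = i then x j else 1)"
    by (rule prod.cong) auto
  then show "x i = (\<Sum>k\<in>{()}. 1 * (\<Prod>j<d. x j ^ (if j = i then 1 else 0)))"
    using assms by (simp add: prod.delta)
qed simp

lemma polynomial_in_vars_mult:
  assumes "polynomial_in_vars d g" "polynomial_in_vars d h"
  shows "polynomial_in_vars d (\<lambda>x. g x * h x)"
proof -
  obtain A a where A: "finite A" "\<And>x. g x = (\<Sum>\<alpha>\<in>A. a \<alpha> * (\<Prod>i<d. x i ^ \<alpha> i))"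
    using assms(1) unfolding polynomial_in_vars_def by blast
  obtain B b where B: "finite B" "\<And>x. h x = (\<Sum>\<alpha>\<in>B. b \<alpha> * (\<Prod>i<d. x i ^ \<alpha> i))"
    using assms(2) unfolding polynomial_in_vars_def by blast
  show ?thesis
  proof (rule polynomial_in_varsI)
    show "finite (A \<times> B)"
      using A B by simp
    show "g x * h x = (\<Sum>p\<in>A \<times> B. (a (fst p) * b (snd p)) *
        (\<Prod>i<d. x i ^ (fst p i + snd p i)))" for x
      unfolding A(2) B(2) sum_product sum.cartesian_product
      by (auto simp: power_add prod.distrib intro!: sum.cong)
  qed
qed

lemma polynomial_in_vars_add:
  assumes "polynomial_in_vars d g" "polynomial_in_vars d h"
  shows "polynomial_in_vars d (\<lambda>x. g x + h x)"
proof -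
  obtain A a where A: "finite A" "\<And>x. g x = (\<Sum>\<alpha>\<in>A. a \<alpha> * (\<Prod>i<d. x i ^ \<alpha> i))"
    using assms(1) unfolding polynomial_in_vars_def by blast
  obtain B b where B: "finite B" "\<And>x. h x = (\<Sum>\<alpha>\<in>B. b \<alpha> * (\<Prod>i<d. x i ^ \<alpha> i))"
    using assms(2) unfolding polynomial_in_vars_def by blast
  show ?thesis
  proof (rule polynomial_in_varsI)
    show "finite (A <+> B)"
      using A B by simp
    show "g x + h x = (\<Sum>p\<in>A <+> B. case_sum a b p * (\<Prod>i<d. x i ^ case_sum id id p i))" for x
      using A B by (simp add: sum.Plus)
  qed
qed

lemma polynomial_in_vars_sum:
  "(\<And>i. i \<in> I \<Longrightarrow> polynomial_in_vars d (g i)) \<Longrightarrow> polynomial_in_vars d (\<lambda>x. \<Sum>i\<in>I. g i x)"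
  by (induction I rule: infinite_finite_induct)
    (auto intro: polynomial_in_vars_const polynomial_in_vars_add)

lemma polynomial_in_vars_power:
  "polynomial_in_vars d g \<Longrightarrow> polynomial_in_vars d (\<lambda>x. g x ^ k)"
  by (induction k) (auto intro: polynomial_in_vars_const polynomial_in_vars_mult)

text \<open>Exact counterpart of \<open>low_rank_approximable\<close>: an identity at all points,
  with no error and no domain, so that ranks can be tracked through sums and products before any
  approximation enters.\<close>

definition polynomial_kernel_rank_le ::
  "nat \<Rightarrow> ((nat \<Rightarrow> real) \<Rightarrow> (nat \<Rightarrow> real) \<Rightarrow> real) \<Rightarrow> nat \<Rightarrow> bool" where
  "polynomial_kernel_rank_le d K R \<longleftrightarrow>
     (\<exists>g h. (\<forall>i<R. polynomial_in_vars d (g i) \<and> polynomial_in_vars d (h i)) \<and>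
        (\<forall>x y. K x y = (\<Sum>i<R. g i x * h i y)))"

lemma polynomial_kernel_rank_le_const: "polynomial_kernel_rank_le d (\<lambda>x y. c) 1"
  unfolding polynomial_kernel_rank_le_def
  by (intro exI[of _ "\<lambda>_ _. c"] exI[of _ "\<lambda>_ _. 1"]) (auto intro: polynomial_in_vars_const)

lemma polynomial_kernel_rank_le_add:
  assumes "polynomial_kernel_rank_le d K R" "polynomial_kernel_rank_le d K' R'"
  shows "polynomial_kernel_rank_le d (\<lambda>x y. K x y + K' x y) (R + R')"
proof -
  obtain g h where gh: "\<forall>i<R. polynomial_in_vars d (g i) \<and> polynomial_in_vars d (h i)"
    "\<forall>x y. K x y = (\<Sum>i<R. g i x * h i y)"
    using assms(1) unfolding polynomial_kernel_rank_le_def by blast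
  obtain g' h' where gh': "\<forall>i<R'. polynomial_in_vars d (g' i) \<and> polynomial_in_vars d (h' i)"
    "\<forall>x y. K' x y = (\<Sum>i<R'. g' i x * h' i y)"
    using assms(2) unfolding polynomial_kernel_rank_le_def by blast
  define G where "G i = (if i < R then g i else g' (i - R))" for i
  define H where "H i = (if i < R then h i else h' (i - R))" for i
  \<comment> \<open>The upper limit \<open>N\<close> is left free for the induction; the case needed
    is \<open>N = R'\<close>.\<close>
  have "(\<Sum>i<R + N. G i x * H i y) = (\<Sum>i<R. g i x * h i y) + (\<Sum>i<N. g' i x * h' i y)" for x y N
    by (induction N) (auto simp: G_def H_def)
  moreover have "\<forall>i<R + R'. polynomial_in_vars d (G i) \<and> polynomial_in_vars d (H i)"
    using gh gh' by (auto simp: G_def H_def)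
  ultimately show ?thesis
    unfolding polynomial_kernel_rank_le_def using gh(2) gh'(2) by metis
qed

lemma polynomial_kernel_rank_le_sum:
  "(\<And>j. j \<le> n \<Longrightarrow> polynomial_kernel_rank_le d (K j) (R j)) \<Longrightarrow>
    polynomial_kernel_rank_le d (\<lambda>x y. \<Sum>j\<le>n. K j x y) (\<Sum>j\<le>(n::nat). R j)"
  by (induction n) (auto intro!: polynomial_kernel_rank_le_add)

lemma polynomial_kernel_rank_le_mult_separable:
  assumes "polynomial_kernel_rank_le d K R" "polynomial_in_vars d a" "polynomial_in_vars d b"
  shows "polynomial_kernel_rank_le d (\<lambda>x y. a x * b y * K x y) R"
proof -
  obtain g h where gh: "\<forall>i<R. polynomial_in_vars d (g i) \<and> polynomial_in_vars d (h i)"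
    "\<forall>x y. K x y = (\<Sum>i<R. g i x * h i y)"
    using assms(1) unfolding polynomial_kernel_rank_le_def by blast
  show ?thesis
    unfolding polynomial_kernel_rank_le_def
    by (intro exI[of _ "\<lambda>i x. a x * g i x"] exI[of _ "\<lambda>i y. b y * h i y"])
      (use gh assms in \<open>auto intro!: polynomial_in_vars_mult sum.cong simp: sum_distrib_left\<close>)
qed

text \<open>Binomial theorem, then the triangle of exponent pairs is summed with the exponent
  \<open>j\<close> of \<open>u\<close> outermost. What multiplies \<open>u ^ j\<close> is a
  polynomial in \<open>s\<close> of degree at most \<open>n - j\<close>, which permits peeling off
  one summand at a time.\<close>

lemma polynomial_add_expansion:
  fixes c :: "nat \<Rightarrow> real"
  shows "(\<Sum>k\<le>n. c k * (u + s) ^ k) =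
    (\<Sum>j\<le>n. u ^ j * (\<Sum>l\<le>n - j. c (j + l) * real ((j + l) choose j) * s ^ l))"
proof -
  define t where "t j l = c (j + l) * real ((j + l) choose j) * u ^ j * s ^ l" for j l
  have "(\<Sum>k\<le>n. c k * (u + s) ^ k) = (\<Sum>k\<le>n. \<Sum>j\<le>k. t j (k - j))"
    by (auto simp: binomial_ring sum_distrib_left t_def mult_ac intro!: sum.cong)
  also have "\<dots> = (\<Sum>(j, l)\<in>{(j, l). j + l \<le> n}. t j l)"
    by (rule sum.triangle_reindex_eq [symmetric])
  also have "{(j, l). j + l \<le> n} = Sigma {..n} (\<lambda>j. {..n - j})"
    by auto
  also have "(\<Sum>(j, l)\<in>Sigma {..n} (\<lambda>j. {..n - j}). t j l) = (\<Sum>j\<le>n. \<Sum>l\<le>n - j. t j l)"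
    by (rule sum.Sigma [symmetric]) auto
  also have "\<dots> = (\<Sum>j\<le>n. u ^ j * (\<Sum>l\<le>n - j. c (j + l) * real ((j + l) choose j) * s ^ l))"
    by (auto simp: t_def sum_distrib_left mult_ac intro!: sum.cong)
  finally show ?thesis .
qed

text \<open>The rank counts the monomials of degree at most \<open>n\<close> in \<open>m\<close> variables.\<close>

lemma polynomial_kernel_rank_le_polynomial_of_sum:
  assumes "\<And>i. i < m \<Longrightarrow> polynomial_in_vars d (a i)" "\<And>i. i < m \<Longrightarrow> polynomial_in_vars d (b i)"
  shows "polynomial_kernel_rank_le d (\<lambda>x y. \<Sum>k\<le>n. c k * (\<Sum>i<m. a i x * b i y) ^ k)
    ((n + m) choose m)"
  using assms
proof (induction m arbitrary: n c)
  case 0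
  \<comment> \<open>An empty sum of products is 0, and since \<open>0 ^ 0 = 1\<close> only the
    constant coefficient survives.\<close>
  have "(\<Sum>k\<le>n. c k * (0::real) ^ k) = c 0"
    by (simp add: power_0_left if_distrib sum.delta cong: if_cong)
  then show ?case
    using polynomial_kernel_rank_le_const[of d "c 0"] by simp
next
  case (Suc m)
  \<comment> \<open>The last product is split off. Its \<open>j\<close>-th power is one separate
    product and costs no rank; the cofactor has degree bound \<open>n - j\<close> and new
    coefficients, which is why \<open>n\<close> and \<open>c\<close> vary in the induction. The
    ranks then add up by the hockey-stick identity.\<close>
  have "polynomial_kernel_rank_le d (\<lambda>x y. \<Sum>j\<le>n. (a m x ^ j * b m y ^ j) *
      (\<Sum>l\<le>n - j. (c (j + l) * real ((j + l) choose j)) * (\<Sum>i<m. a i x * b i y) ^ l))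
      (\<Sum>j\<le>n. (n - j + m) choose m)"
    using Suc.prems
    by (intro polynomial_kernel_rank_le_sum polynomial_kernel_rank_le_mult_separable Suc.IH
        polynomial_in_vars_power) auto
  moreover have "(\<Sum>j\<le>n. (n - j + m) choose m) = (\<Sum>j\<le>n. (m + j) choose m)"
    by (rule sum.reindex_bij_witness[of _ "\<lambda>j. n - j" "\<lambda>j. n - j"]) (auto simp: add.commute)
  moreover have "(\<Sum>j\<le>n. (m + j) choose m) = (n + Suc m) choose Suc m"
    using choose_rising_sum(1)[of m n] by (simp add: add.commute)
  moreover have "(\<Sum>k\<le>n. c k * (\<Sum>i<Suc m. a i x * b i y) ^ k) =
      (\<Sum>j\<le>n. (a m x ^ j * b m y ^ j) *
        (\<Sum>l\<le>n - j. (c (j + l) * real ((j + l) choose j)) * (\<Sum>i<m. a i x * b i y) ^ l))" for x y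
    using polynomial_add_expansion[where u = "a m x * b m y" and s = "\<Sum>i<m. a i x * b i y"]
    by (simp add: add.commute power_mult_distrib)
  ultimately show ?case
    by simp
qed

text \<open>The squared distance splits into the \<open>d + 2\<close> products \<open>-2 x\<^sub>i y\<^sub>i\<close>, \<open>\<parallel>x\<parallel>\<^sup>2 \<cdot> 1\<close> and
  \<open>1 \<cdot> \<parallel>y\<parallel>\<^sup>2\<close>.\<close>

lemma polynomial_kernel_rank_le_poly_dist_sq:
  assumes "degree p \<le> n"
  shows "polynomial_kernel_rank_le d (\<lambda>x y. poly p (dist_sq d x y)) (rank_bound n d)"
proof -
  define a where "a i x = (if i < d then - 2 * x i else if i = d then \<Sum>j<d. x j ^ 2 else 1)"
    for i and x :: "nat \<Rightarrow> real"
  define b where "b i y = (if i < d then y i else if i = d then 1 else \<Sum>j<d. y j ^ 2)"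
    for i and y :: "nat \<Rightarrow> real"
  have "(\<Sum>i<d. a i x * b i y) = (\<Sum>i<d. - 2 * x i * y i)" for x y
    by (rule sum.cong) (auto simp: a_def b_def)
  then have dist: "(\<Sum>i<d + 2. a i x * b i y) = dist_sq d x y" for x y
    by (simp add: dist_sq_def a_def b_def power2_diff sum.distrib sum_subtractf sum_negf algebra_simps)
  have "polynomial_in_vars d (a i)" for i
    unfolding a_def
    using polynomial_in_vars_mult[OF polynomial_in_vars_const[of d "- 2"] polynomial_in_vars_var]
    by (cases "i < d"; cases "i = d")
      (auto intro!: polynomial_in_vars_sum polynomial_in_vars_power polynomial_in_vars_var
        polynomial_in_vars_const)
  moreover have "polynomial_in_vars d (b i)" for i
    unfolding b_def
    by (cases "i < d"; cases "i = d")
      (auto intro!: polynomial_in_vars_sum polynomial_in_vars_power polynomial_in_vars_var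
        polynomial_in_vars_const)
  ultimately have "polynomial_kernel_rank_le d
      (\<lambda>x y. \<Sum>k\<le>n. coeff p k * (\<Sum>i<d + 2. a i x * b i y) ^ k) ((n + (d + 2)) choose (d + 2))"
    by (intro polynomial_kernel_rank_le_polynomial_of_sum) auto
  moreover have "poly p t = (\<Sum>k\<le>n. coeff p k * t ^ k)" for t
    unfolding poly_altdef using assms by (intro sum.mono_neutral_left) (auto simp: coeff_eq_0)
  ultimately show ?thesis
    unfolding dist by (simp add: rank_bound_def add.assoc)
qed

section \<open>From polynomial approximation of \<open>f\<close> to low-rank approximation of the
  kernel\<close>

lemma dist_sq_bounds:
  assumes "d \<ge> 1" "x \<in> cube d D" "y \<in> cube d D"
  shows "dist_sq d x y \<in> {0..D\<^sup>2}"
proof -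
  have "(x i - y i)\<^sup>2 \<le> D\<^sup>2 / real d" if "i < d" for i
  proof -
    have "x i \<in> {0..D / sqrt (real d)}" "y i \<in> {0..D / sqrt (real d)}"
      using assms(2,3) that unfolding cube_def by (auto dest!: PiE_mem[of _ _ _ i])
    then have "\<bar>x i - y i\<bar> \<le> D / sqrt (real d)"
      unfolding atLeastAtMost_iff by linarith
    then have "(x i - y i)\<^sup>2 \<le> (D / sqrt (real d))\<^sup>2"
      using power_mono[of "\<bar>x i - y i\<bar>" _ 2] by simp
    then show ?thesis
      by (simp add: power_divide)
  qed
  then have "(\<Sum>i<d. (x i - y i)\<^sup>2) \<le> (\<Sum>i<d. D\<^sup>2 / real d)"
    by (intro sum_mono) auto
  then show ?thesis
    using assms(1) by (auto simp: dist_sq_def intro!: sum_nonneg)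
qed

lemma low_rank_approximable_if_poly_approx:
  assumes "degree p \<le> n" "\<And>t. t \<in> {0..D\<^sup>2} \<Longrightarrow> \<bar>f t - poly p t\<bar> \<le> \<epsilon>" "d \<ge> 1"
  shows "low_rank_approximable d (cube d D) (\<lambda>x y. f (dist_sq d x y)) (rank_bound n d) \<epsilon>"
proof -
  obtain g h where "\<forall>i<rank_bound n d. polynomial_in_vars d (g i) \<and> polynomial_in_vars d (h i)"
    and "\<forall>x y. poly p (dist_sq d x y) = (\<Sum>i<rank_bound n d. g i x * h i y)"
    using polynomial_kernel_rank_le_poly_dist_sq[OF assms(1), of d]
    unfolding polynomial_kernel_rank_le_def by blast
  then show ?thesis
    unfolding low_rank_approximable_def
    using assms(2) dist_sq_bounds[OF assms(3)] by metis
qed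

text \<open>Padding with zero products raises the rank. This lets a rank be rounded up to a value of
  a prescribed growth.\<close>

lemma low_rank_approximable_mono:
  assumes "low_rank_approximable d S K R \<epsilon>" "R \<le> R'" "\<epsilon> \<le> \<epsilon>'"
  shows "low_rank_approximable d S K R' \<epsilon>'"
proof -
  obtain g h where gh: "\<forall>i<R. polynomial_in_vars d (g i) \<and> polynomial_in_vars d (h i)"
    "\<forall>x\<in>S. \<forall>y\<in>S. \<bar>K x y - (\<Sum>i<R. g i x * h i y)\<bar> \<le> \<epsilon>"
    using assms(1) unfolding low_rank_approximable_def by blast
  define G where "G i = (if i < R then g i else (\<lambda>x. 0))" for i
  define H where "H i = (if i < R then h i else (\<lambda>x. 0))" for i
  have "(\<Sum>i<R'. G i x * H i y) = (\<Sum>i<R. g i x * h i y)" for x y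
    using \<open>R \<le> R'\<close> by (intro sum.mono_neutral_cong_right) (auto simp: G_def H_def)
  moreover have "\<forall>i<R'. polynomial_in_vars d (G i) \<and> polynomial_in_vars d (H i)"
    using gh by (auto simp: G_def H_def intro: polynomial_in_vars_const)
  ultimately show ?thesis
    unfolding low_rank_approximable_def
    using gh(2) \<open>\<epsilon> \<le> \<epsilon>'\<close>
    by - (rule exI[of _ G], rule exI[of _ H], fastforce)
qed

subsection \<open>Polynomial approximation on a Bernstein ellipse\<close>

lemma
  assumes "r > 1"
  shows bernstein_ellipse_eq: "bernstein_ellipse r =
      (\<lambda>z. Complex ((r + inverse r) / 2 * Re z) ((r - inverse r) / 2 * Im z)) ` ball 0 1"
    and open_bernstein_ellipse: "open (bernstein_ellipse r)"
proof -
  define A B where "A = (r + inverse r) / 2" and "B = (r - inverse r) / 2"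
  define L where "L z = Complex (A * Re z) (B * Im z)" for z
  have "inverse r < 1"
    using assms by (simp add: inverse_less_1_iff)
  then have "r - inverse r > 0"
    using assms by linarith
  moreover have "r + inverse r > 0"
    using assms by (intro add_pos_pos) auto
  ultimately have pos: "A > 0" "B > 0"
    by (simp_all add: A_def B_def)
  have lin: "linear L"
    by (rule linearI) (simp_all add: L_def complex_eq_iff algebra_simps)
  have inj: "inj L"
  proof (rule injI)
    fix z w
    assume "L z = L w"
    then have "A * Re z = A * Re w" "B * Im z = B * Im w"
      by (simp_all add: L_def)
    then show "z = w"
      using pos by (simp add: complex_eq_iff)
  qed
  have point: "L (cis \<theta>) = (of_real r * cis \<theta> + of_real (inverse r) * cis (- \<theta>)) / 2" for \<theta>
  proof -
    define t where "t = inverse r"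
    show ?thesis
      unfolding L_def A_def B_def t_def[symmetric] by (simp add: complex_eq_iff field_simps)
  qed
  have "sphere 0 1 = cis ` {0..<2 * pi}"
  proof (intro equalityI subsetI)
    fix z :: complex
    assume "z \<in> sphere 0 1"
    then have "z = cis (Arg2pi z)"
      using complex_norm_eq_1_exp[of z] by (simp add: cis_conv_exp)
    then show "z \<in> cis ` {0..<2 * pi}"
      using Arg2pi[of z] by auto
  qed auto
  then have "bernstein_curve r = L ` sphere 0 1"
    unfolding bernstein_curve_def point[symmetric] by auto
  also have "\<dots> = L ` cball 0 1 - L ` ball 0 1"
    unfolding image_set_diff[OF inj, symmetric] by (rule arg_cong[of _ _ "image L"]) auto
  also have "\<dots> = frontier (L ` cball 0 1)"
  proof -
    have "closed (L ` cball 0 1)"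
      using lin by (intro compact_imp_closed compact_continuous_image linear_continuous_on)
        (auto simp: linear_conv_bounded_linear)
    then show ?thesis
      unfolding frontier_def interior_injective_linear_image[OF lin inj] by simp
  qed
  finally have "bernstein_ellipse r = inside (frontier (L ` cball 0 1))"
    by (simp add: bernstein_ellipse_def)
  also have "\<dots> = interior (L ` cball 0 1)"
    using lin by (intro inside_frontier_eq_interior bounded_linear_image convex_linear_image)
      (auto simp: linear_conv_bounded_linear)
  finally have interior: "bernstein_ellipse r = interior (L ` cball 0 1)" .
  then show "open (bernstein_ellipse r)"
    by simp
  show "bernstein_ellipse r =
      (\<lambda>z. Complex ((r + inverse r) / 2 * Re z) ((r - inverse r) / 2 * Im z)) ` ball 0 1"
    unfolding interior interior_injective_linear_image[OF lin inj]
    by (simp add: L_def[abs_def] A_def B_def)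
qed

lemma convex_bernstein_ellipse:
  assumes "r > 1"
  shows "convex (bernstein_ellipse r)"
proof -
  have "linear (\<lambda>z. Complex (a * Re z) (b * Im z))" for a b
    by (rule linearI) (simp_all add: complex_eq_iff algebra_simps)
  then show ?thesis
    unfolding bernstein_ellipse_eq[OF assms] by (intro convex_linear_image convex_ball)
qed

definition joukowski :: "complex \<Rightarrow> complex" where
  "joukowski w = (w + inverse w) / 2"

text \<open>The circle of radius \<open>s\<close> goes to the confocal ellipse with half-axes
  \<open>(s + 1/s) / 2\<close> and \<open>(s - 1/s) / 2\<close>, both smaller than those for
  \<open>r\<close>. For \<open>s = 1\<close> it degenerates to the segment from -1 to 1.\<close>

lemma joukowski_in_bernstein_ellipse:
  assumes "1 \<le> norm w" "norm w < r"
  shows "joukowski w \<in> bernstein_ellipse r"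
proof -
  define s \<theta> where "s = norm w" and "\<theta> = Arg w"
  have s: "1 \<le> s" "s < r"
    using assms by (auto simp: s_def)
  then have "inverse r < inverse s" "inverse s \<le> 1" "inverse r > 0"
    by (auto simp: inverse_le_1_iff)
  define A B where "A = r + inverse r" and "B = r - inverse r"
  define a b where "a = s + inverse s" and "b = s - inverse s"
  \<comment> \<open>This factorization shows that \<open>s + 1/s\<close> increases on the range
    \<open>s >= 1\<close>.\<close>
  have "A - a = (r - s) * (1 - inverse r * inverse s)"
    using s by (simp add: A_def a_def field_simps)
  moreover have "inverse r * inverse s < 1"
  proof -
    have "inverse r * inverse s \<le> inverse r * 1"
      using \<open>inverse s \<le> 1\<close> \<open>inverse r > 0\<close> by (intro mult_left_mono) auto
    then show ?thesis
      using \<open>inverse r < inverse s\<close> \<open>inverse s \<le> 1\<close> by linarith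
  qed
  ultimately have "A - a > 0"
    using s by simp
  then have "a < A"
    by simp
  have "0 \<le> b" "b < B"
    using s \<open>inverse r < inverse s\<close> \<open>inverse s \<le> 1\<close> unfolding b_def B_def by linarith+
  have "0 < a"
    using s by (auto simp: a_def intro!: add_pos_pos)
  \<comment> \<open>The larger of the two half-axis ratios. The point \<open>z\<close> below is the
    preimage of \<open>joukowski w\<close> under the linear map of the ellipse, and its norm is at
    most this ratio.\<close>
  define \<mu> where "\<mu> = max (a / A) (b / B)"
  have \<mu>: "0 \<le> \<mu>" "\<mu> < 1"
    using \<open>a < A\<close> \<open>0 \<le> b\<close> \<open>b < B\<close> \<open>0 < a\<close> by (auto simp: \<mu>_def le_max_iff_disj)
  define z where "z = Complex (a / A * cos \<theta>) (b / B * sin \<theta>)"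
  have "(norm z)\<^sup>2 = (a / A)\<^sup>2 * (cos \<theta>)\<^sup>2 + (b / B)\<^sup>2 * (sin \<theta>)\<^sup>2"
    by (simp add: z_def cmod_power2 power_mult_distrib power_divide)
  also have "\<dots> \<le> \<mu>\<^sup>2 * (cos \<theta>)\<^sup>2 + \<mu>\<^sup>2 * (sin \<theta>)\<^sup>2"
    using \<open>a < A\<close> \<open>0 \<le> b\<close> \<open>b < B\<close> \<open>0 < a\<close>
    by (intro add_mono mult_right_mono power_mono) (auto simp: \<mu>_def)
  also have "\<dots> = \<mu>\<^sup>2"
    by (simp flip: distrib_left)
  also have "\<dots> < 1"
    using \<mu> by (simp add: power_less_one_iff)
  finally have "norm z < 1"
    using power_less_imp_less_base[of "norm z" 2 1] by simp
  have "w = of_real s * cis \<theta>"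
    using rcis_cmod_Arg[of w] by (simp add: s_def \<theta>_def rcis_def)
  then have "inverse w = of_real (inverse s) * cis (- \<theta>)"
    by (simp add: cis_inverse)
  with \<open>w = of_real s * cis \<theta>\<close> have "joukowski w = Complex (a / 2 * cos \<theta>) (b / 2 * sin \<theta>)"
    unfolding joukowski_def a_def b_def
    by (simp add: complex_eq_iff field_simps del: inverse_mult_distrib of_real_inverse)
  also have "\<dots> = Complex (A / 2 * Re z) (B / 2 * Im z)"
    using \<open>a < A\<close> \<open>0 \<le> b\<close> \<open>b < B\<close> \<open>0 < a\<close> by (simp add: z_def)
  finally have "joukowski w = Complex (A / 2 * Re z) (B / 2 * Im z)" .
  moreover have "r > 1"
    using s by simp
  ultimately show ?thesis
    using \<open>norm z < 1\<close> unfolding bernstein_ellipse_eq[OF \<open>r > 1\<close>] A_def B_def by auto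
qed

section \<open>Cauchy's formula on the Joukowski image of a circle, and its truncated series\<close>

lemma has_contour_integral_circlepath_inverse_shift:
  assumes "norm v < s"
  shows "((\<lambda>w. 1 / (w - v)) has_contour_integral (2 * pi * \<i>)) (circlepath 0 s)"
  using Cauchy_integral_circlepath_simple[of "\<lambda>_. 1" 0 s v] assms by simp

lemma holomorphic_on_joukowski [holomorphic_intros]:
  "0 \<notin> S \<Longrightarrow> joukowski holomorphic_on S"
  unfolding joukowski_def[abs_def] by (intro holomorphic_intros) auto

text \<open>Cauchy's formula on the ellipse \<open>joukowski ` {w. norm w = s}\<close>, pulled back to the circle:
  the kernel is the logarithmic derivative in \<open>w\<close> of
  \<open>joukowski w - joukowski v = (w - v) (w - inverse v) / (2 w)\<close>.\<close>

lemma Cauchy_integral_joukowski: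
  assumes "1 < s" "s < r" "F holomorphic_on bernstein_ellipse r" "norm v = 1"
  shows "((\<lambda>w. F (joukowski w) * (1 / (w - v) + 1 / (w - inverse v) - 1 / w))
    has_contour_integral (2 * pi * \<i> * F (joukowski v))) (circlepath 0 s)"
proof -
  let ?k = "\<lambda>w. 1 / (w - v) + 1 / (w - inverse v) - 1 / w"
  let ?E = "bernstein_ellipse r"
  define \<gamma> where "\<gamma> = joukowski \<circ> circlepath 0 s"
  define z where "z = joukowski v"
  have norm_iv: "norm (inverse v) = 1" and v0: "v \<noteq> 0"
    using assms(4) by (auto simp: norm_inverse)
  have ne: "w \<noteq> 0" "w \<noteq> v" "w \<noteq> inverse v" if "w \<in> sphere 0 s" for w
    using that assms norm_iv by auto
  have diff_eq: "joukowski w - z = (w - v) * (w - inverse v) / (2 * w)" if "w \<noteq> 0" for w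
    using that v0 by (simp add: joukowski_def z_def field_simps)
  have "open (- {0::complex})"
    by auto
  have sphere: "sphere 0 s \<subseteq> - {0::complex}"
    using assms(1) by auto
  have hol: "joukowski holomorphic_on - {0}"
    by (intro holomorphic_intros) auto
  have in_E: "joukowski w \<in> ?E" if "w \<in> sphere 0 s" for w
    using that assms by (intro joukowski_in_bernstein_ellipse) auto
  have "z \<in> ?E"
    using assms by (auto simp: z_def intro!: joukowski_in_bernstein_ellipse)
  have valid: "valid_path \<gamma>"
    unfolding \<gamma>_def using sphere assms(1)
    by (intro valid_path_compose_holomorphic[OF _ hol]) auto
  have loop: "pathfinish \<gamma> = pathstart \<gamma>"
    by (simp add: \<gamma>_def pathfinish_compose pathstart_compose)
  have image: "path_image \<gamma> \<subseteq> ?E - {z}"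
  proof
    fix \<zeta>
    assume "\<zeta> \<in> path_image \<gamma>"
    then obtain w where w: "w \<in> sphere 0 s" "\<zeta> = joukowski w"
      using assms(1) by (auto simp: \<gamma>_def path_image_compose)
    then have "joukowski w - z \<noteq> 0"
      using ne[OF w(1)] by (simp add: diff_eq)
    then show "\<zeta> \<in> ?E - {z}"
      using w in_E by auto
  qed
  have deriv: "deriv joukowski w * (G (joukowski w) / (joukowski w - z)) = G (joukowski w) * ?k w"
    if "w \<in> sphere 0 s" for w G
  proof -
    have "(joukowski has_field_derivative (1 - inverse (w ^ 2)) / 2) (at w)"
      unfolding joukowski_def[abs_def] using ne[OF that]
      by (auto intro!: derivative_eq_intros simp: power2_eq_square field_simps)
    then have "deriv joukowski w = (1 - inverse (w ^ 2)) / 2"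
      by (rule DERIV_imp_deriv)
    \<comment> \<open>Over a common denominator the three fractions have numerator
      \<open>w * w - v * u\<close>, which is \<open>w * w - 1\<close> because \<open>u\<close> is
      the inverse of \<open>v\<close>.\<close>
    moreover have "(1 - inverse (w ^ 2)) / 2 / ((w - v) * (w - inverse v) / (2 * w)) = ?k w"
    proof -
      define u where "u = inverse v"
      have "v * u = 1"
        using v0 by (simp add: u_def)
      have "w \<noteq> 0" "w - v \<noteq> 0" "w - u \<noteq> 0"
        using ne[OF that] by (auto simp: u_def)
      then have "?k w = (w * w - v * u) / (w * ((w - v) * (w - u)))"
        unfolding u_def[symmetric]
        by (simp add: divide_simps) (simp add: algebra_simps)
      also have "\<dots> = (1 - inverse (w ^ 2)) / 2 / ((w - v) * (w - u) / (2 * w))"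
        unfolding \<open>v * u = 1\<close> using \<open>w \<noteq> 0\<close> \<open>w - v \<noteq> 0\<close> \<open>w - u \<noteq> 0\<close>
        by (simp add: divide_simps) (simp add: algebra_simps power2_eq_square)
      finally show ?thesis
        by (simp add: u_def)
    qed
    ultimately show ?thesis
      using diff_eq[of w] ne[OF that] by (metis mult.commute times_divide_eq_left)
  qed
  \<comment> \<open>Stated for arbitrary \<open>G\<close> because it is used twice:
    \<open>G = 1\<close> yields the winding number and \<open>G = F\<close> the Cauchy
    integral.\<close>
  have pull_back: "contour_integral \<gamma> (\<lambda>\<zeta>. G \<zeta> / (\<zeta> - z)) =
      contour_integral (circlepath 0 s) (\<lambda>w. G (joukowski w) * ?k w)" for G
  proof -
    have "contour_integral \<gamma> (\<lambda>\<zeta>. G \<zeta> / (\<zeta> - z)) = contour_integral (circlepath 0 s)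
        (\<lambda>w. deriv joukowski w * (G (joukowski w) / (joukowski w - z)))"
      unfolding \<gamma>_def using hol sphere assms(1)
      by (intro contour_integral_comp_analyticW[of _ "- {0}"])
        (auto simp: analytic_on_open[OF \<open>open (- {0})\<close>])
    also have "\<dots> = contour_integral (circlepath 0 s) (\<lambda>w. G (joukowski w) * ?k w)"
      using deriv assms(1) by (intro contour_integral_eq) auto
    finally show ?thesis .
  qed
  \<comment> \<open>The points \<open>v\<close>, \<open>inverse v\<close> and 0 all lie inside the
    circle, so each fraction contributes \<open>2 * pi * i\<close> up to sign. The total is that of
    a single turn around \<open>z\<close>.\<close>
  have "(?k has_contour_integral (2 * pi * \<i> + 2 * pi * \<i> - 2 * pi * \<i>)) (circlepath 0 s)"
    using has_contour_integral_circlepath_inverse_shift[of v s]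
      has_contour_integral_circlepath_inverse_shift[of "inverse v" s]
      has_contour_integral_circlepath_inverse_shift[of 0 s] assms norm_iv
    by (intro has_contour_integral_diff has_contour_integral_add) auto
  then have "contour_integral \<gamma> (\<lambda>\<zeta>. 1 / (\<zeta> - z)) = 2 * pi * \<i>"
    using pull_back[of "\<lambda>_. 1"] contour_integral_unique by fastforce
  then have "winding_number \<gamma> z = 1"
    using image by (subst winding_number_valid_path[OF valid]) auto
  then have "((\<lambda>\<zeta>. F \<zeta> / (\<zeta> - z)) has_contour_integral (2 * pi * \<i> * F z)) \<gamma>"
    using Cauchy_integral_formula_convex_simple[OF convex_bernstein_ellipse assms(3) _ valid image loop]
      \<open>z \<in> ?E\<close> assms open_bernstein_ellipse by (simp add: interior_open)
  then have "contour_integral (circlepath 0 s) (\<lambda>w. F (joukowski w) * ?k w) = 2 * pi * \<i> * F z"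
    using pull_back[of F] contour_integral_unique by fastforce
  \<comment> \<open>The value of \<open>contour_integral\<close> alone does not give
    \<open>has_contour_integral\<close>; integrability follows from continuity on the
    circle.\<close>
  moreover have integrable: "(\<lambda>w. F (joukowski w) * ?k w) contour_integrable_on circlepath 0 s"
  proof (rule contour_integrable_continuous_circlepath)
    have "(F \<circ> joukowski) holomorphic_on sphere 0 s"
      using in_E sphere
      by (intro holomorphic_on_compose_gen[OF _ assms(3)] holomorphic_intros) auto
    then have "continuous_on (sphere 0 s) (\<lambda>w. F (joukowski w))"
      by (auto simp: o_def dest: holomorphic_on_imp_continuous_on)
    then show "continuous_on (path_image (circlepath 0 s)) (\<lambda>w. F (joukowski w) * ?k w)"
      using assms(1) ne by (auto intro!: continuous_intros)
  qed
  ultimately show ?thesis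
    using has_contour_integral_integral[OF integrable] unfolding z_def by simp
qed

text \<open>Interpolating linearly between the two circles passes only through concentric circles of
  intermediate radius, which stay in the annulus. This makes the series coefficients independent of
  the radius.\<close>

lemma contour_integral_circlepath_annulus_eq:
  assumes "f holomorphic_on ball 0 r - cball 0 1" "1 < s" "s < r" "1 < s'" "s' < r"
  shows "contour_integral (circlepath 0 s) f = contour_integral (circlepath 0 s') f"
proof (rule Cauchy_theorem_homotopic_loops)
  show "homotopic_loops (ball 0 r - cball 0 1) (circlepath 0 s) (circlepath 0 s')"
  proof (rule homotopic_loops_linear)
    fix t :: real
    show "closed_segment (circlepath 0 s t) (circlepath 0 s' t) \<subseteq> ball 0 r - cball 0 1"
    proof
      fix x
      assume "x \<in> closed_segment (circlepath 0 s t) (circlepath 0 s' t)"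
      then obtain u where u: "0 \<le> u" "u \<le> 1"
        "x = (1 - u) *\<^sub>R circlepath 0 s t + u *\<^sub>R circlepath 0 s' t"
        by (auto simp: in_segment)
      then have "x = of_real ((1 - u) * s + u * s') * exp (2 * of_real pi * \<i> * of_real t)"
        by (simp add: circlepath scaleR_conv_of_real algebra_simps)
      moreover have "norm (exp (2 * of_real pi * \<i> * of_real t)) = 1"
        using norm_exp_i_times[of "2 * pi * t"] by (simp add: mult_ac)
      ultimately have "norm x = \<bar>(1 - u) * s + u * s'\<bar>"
        by (simp only: norm_mult norm_of_real mult_1_right)
      moreover have "(1 - u) * s + u * s' \<in> {1<..<r}"
        using convexD[OF convex_real_interval(8), of s 1 r s' "1 - u" u] u(1,2) assms by simp
      ultimately show "x \<in> ball 0 r - cball 0 1"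
        by auto
    qed
  qed auto
qed (use assms in auto)

text \<open>The finite geometric series with its exact remainder, so that no infinite sum has to be
  exchanged with an integral.\<close>

lemma inverse_diff_geometric:
  fixes w v :: complex
  assumes "w \<noteq> 0" "w \<noteq> v"
  shows "1 / (w - v) = (\<Sum>k\<le>n. v ^ k / w ^ Suc k) + v ^ Suc n / (w ^ Suc n * (w - v))"
proof (induction n)
  case 0
  show ?case
    using assms by (simp add: field_simps)
next
  case (Suc n)
  have "v ^ Suc n / (w ^ Suc n * (w - v)) =
      v ^ Suc n / w ^ Suc (Suc n) + v ^ Suc (Suc n) / (w ^ Suc (Suc n) * (w - v))"
    using assms by (simp add: divide_simps) (simp add: algebra_simps)
  then show ?case
    using Suc by simp
qed

text \<open>Both \<open>1 / (w - v)\<close> and \<open>1 / (w - inverse v)\<close> are expanded.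
  Their terms with \<open>k = 0\<close> are each \<open>1 / w\<close>, and the kernel's
  \<open>- 1 / w\<close> removes one of them; hence the correction at \<open>k = 0\<close>. The two
  remainders are then estimated on the circle.\<close>

lemma joukowski_partial_sum_error:
  assumes "1 < s" "s < r" "F holomorphic_on bernstein_ellipse r"
    and bound: "\<And>z. z \<in> bernstein_ellipse r \<Longrightarrow> norm (F z) \<le> C" and "norm v = 1"
  shows "norm (F (joukowski v) -
      (\<Sum>k\<le>n. contour_integral (circlepath 0 s) (\<lambda>w. F (joukowski w) / w ^ Suc k) / (2 * pi * \<i>) *
        (v ^ k + inverse v ^ k - (if k = 0 then 1 else 0)))) \<le> 2 * C / (s ^ n * (s - 1))"
proof -
  define u where "u = inverse v"
  have norm_u: "norm u = 1"
    using assms by (simp add: u_def norm_inverse)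
  define c where "c k = contour_integral (circlepath 0 s) (\<lambda>w. F (joukowski w) / w ^ Suc k)" for k
  define e where "e k = v ^ k + u ^ k - (if k = 0 then 1 else 0)" for k
  define rest where "rest w = F (joukowski w) *
    (v ^ Suc n / (w ^ Suc n * (w - v)) + u ^ Suc n / (w ^ Suc n * (w - u)))" for w
  have ne: "w \<noteq> 0" "w \<noteq> v" "w \<noteq> u" if "norm w = s" for w
    using that assms norm_u by auto
  have in_E: "joukowski w \<in> bernstein_ellipse r" if "norm w = s" for w
    using that assms by (intro joukowski_in_bernstein_ellipse) auto
  have "0 \<notin> sphere (0::complex) s"
    using assms(1) by auto
  then have "(F \<circ> joukowski) holomorphic_on sphere 0 s"
    using in_E by (intro holomorphic_on_compose_gen[OF _ assms(3)] holomorphic_intros) auto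
  then have cont: "continuous_on (sphere 0 s) (\<lambda>w. F (joukowski w))"
    by (auto simp: o_def dest: holomorphic_on_imp_continuous_on)
  have c: "((\<lambda>w. F (joukowski w) / w ^ Suc k) has_contour_integral c k) (circlepath 0 s)" for k
    unfolding c_def
    by (intro has_contour_integral_integral contour_integrable_continuous_circlepath)
      (use assms(1) cont ne in \<open>auto intro!: continuous_intros\<close>)
  have sum: "((\<lambda>w. \<Sum>k\<le>n. F (joukowski w) / w ^ Suc k * e k) has_contour_integral (\<Sum>k\<le>n. c k * e k))
      (circlepath 0 s)"
    by (intro has_contour_integral_sum has_contour_integral_rmul c) auto
  have "((\<lambda>w. F (joukowski w) * (1 / (w - v) + 1 / (w - u) - 1 / w) -
      (\<Sum>k\<le>n. F (joukowski w) / w ^ Suc k * e k)) has_contour_integral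
      (2 * pi * \<i> * F (joukowski v) - (\<Sum>k\<le>n. c k * e k))) (circlepath 0 s)"
    unfolding u_def
    by (intro has_contour_integral_diff Cauchy_integral_joukowski[where r = r] assms
        sum[unfolded u_def])
  then have rest: "(rest has_contour_integral
      (2 * pi * \<i> * F (joukowski v) - (\<Sum>k\<le>n. c k * e k))) (circlepath 0 s)"
  proof (rule has_contour_integral_eq)
    fix w
    assume "w \<in> path_image (circlepath 0 s)"
    then have w: "norm w = s"
      using assms(1) by simp
    have "(\<Sum>k\<le>n. e k / w ^ Suc k) =
        (\<Sum>k\<le>n. v ^ k / w ^ Suc k) + (\<Sum>k\<le>n. u ^ k / w ^ Suc k) -
        (\<Sum>k\<le>n. (if k = 0 then 1 else 0) / w ^ Suc k)"
      by (simp add: e_def add_divide_distrib diff_divide_distrib sum.distrib sum_subtractf)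
    also have "(\<Sum>k\<le>n. (if k = 0 then 1 else 0) / w ^ Suc k) = 1 / w"
      by (subst sum.mono_neutral_right[of _ "{0}"]) auto
    finally have "1 / (w - v) + 1 / (w - u) - 1 / w - (\<Sum>k\<le>n. e k / w ^ Suc k) =
        v ^ Suc n / (w ^ Suc n * (w - v)) + u ^ Suc n / (w ^ Suc n * (w - u))"
      using inverse_diff_geometric[of w v n] inverse_diff_geometric[of w u n] ne[OF w] by simp
    moreover have "(\<Sum>k\<le>n. F (joukowski w) / w ^ Suc k * e k) =
        F (joukowski w) * (\<Sum>k\<le>n. e k / w ^ Suc k)"
      by (simp add: sum_distrib_left)
    ultimately show "F (joukowski w) * (1 / (w - v) + 1 / (w - u) - 1 / w) -
        (\<Sum>k\<le>n. F (joukowski w) / w ^ Suc k * e k) = rest w"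
      unfolding rest_def by (simp only: right_diff_distrib[symmetric])
  qed
  \<comment> \<open>The bound on \<open>F\<close> at one point of the ellipse forces this sign,
    which the product estimate below requires.\<close>
  have C: "0 \<le> C"
    using order_trans[OF norm_ge_zero bound[OF in_E[of "of_real s"]]] assms(1) by simp
  have "norm (2 * pi * \<i> * F (joukowski v) - (\<Sum>k\<le>n. c k * e k))
      \<le> (C * (2 / (s ^ Suc n * (s - 1)))) * (2 * pi * s)"
  proof (rule has_contour_integral_bound_circlepath[OF rest])
    fix w :: complex
    assume "norm (w - 0) = s"
    then have w: "norm w = s"
      by simp
    have le: "norm (t ^ Suc n / (w ^ Suc n * (w - t))) \<le> 1 / (s ^ Suc n * (s - 1))"
      if "norm t = 1" for t
    proof -
      have "s - 1 \<le> norm (w - t)"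
        using norm_triangle_ineq2[of w t] w that by simp
      then have "1 / (s ^ Suc n * norm (w - t)) \<le> 1 / (s ^ Suc n * (s - 1))"
        using assms(1) by (intro divide_left_mono mult_left_mono mult_pos_pos) auto
      then show ?thesis
        using w that by (simp add: norm_divide norm_mult norm_power)
    qed
    have "norm (v ^ Suc n / (w ^ Suc n * (w - v)) + u ^ Suc n / (w ^ Suc n * (w - u)))
        \<le> 1 / (s ^ Suc n * (s - 1)) + 1 / (s ^ Suc n * (s - 1))"
      by (rule norm_triangle_mono) (intro le assms norm_u)+
    also have "\<dots> = 2 / (s ^ Suc n * (s - 1))"
      by simp
    finally show "norm (rest w) \<le> C * (2 / (s ^ Suc n * (s - 1)))"
      unfolding rest_def norm_mult by (intro mult_mono bound in_E w C norm_ge_zero)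
  qed (use assms(1) C in auto)
  \<comment> \<open>The circumference cancels one of the \<open>n + 1\<close> factors
    \<open>s\<close>.\<close>
  also have "\<dots> = 2 * C / (s ^ n * (s - 1)) * (2 * pi)"
    using assms(1) by (simp add: field_simps)
  finally have "norm ((2 * pi * \<i> * F (joukowski v) - (\<Sum>k\<le>n. c k * e k)) / (2 * pi * \<i>))
      \<le> 2 * C / (s ^ n * (s - 1))"
    by (simp add: norm_divide norm_mult pos_divide_le_eq)
  also have "(2 * pi * \<i> * F (joukowski v) - (\<Sum>k\<le>n. c k * e k)) / (2 * pi * \<i>) =
      F (joukowski v) - (\<Sum>k\<le>n. c k / (2 * pi * \<i>) * e k)"
    by (simp add: diff_divide_distrib sum_divide_distrib)
  finally show ?thesis
    unfolding c_def e_def u_def .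
qed

text \<open>\<open>F\<close> is controlled on the open ellipse only, so the estimate is made at
  radii \<open>s < r\<close>. As the coefficients do not change with \<open>s\<close>, the left side
  stays fixed while \<open>s\<close> tends to \<open>r\<close> from below.\<close>

lemma bernstein_ellipse_expansion:
  assumes "1 < r" "F holomorphic_on bernstein_ellipse r"
    and bound: "\<And>z. z \<in> bernstein_ellipse r \<Longrightarrow> norm (F z) \<le> C"
  obtains a where "\<And>v n. norm v = 1 \<Longrightarrow>
    norm (F (joukowski v) - (\<Sum>k\<le>n. a k * (v ^ k + inverse v ^ k - (if k = 0 then 1 else 0))))
      \<le> 2 * C / (r ^ n * (r - 1))"
proof -
  define c where
    "c s k = contour_integral (circlepath 0 s) (\<lambda>w. F (joukowski w) / w ^ Suc k)" for s k
  have "(F \<circ> joukowski) holomorphic_on ball 0 r - cball 0 1"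
    by (rule holomorphic_on_compose_gen[OF _ assms(2)])
      (auto intro!: holomorphic_intros joukowski_in_bernstein_ellipse)
  then have "(\<lambda>w. F (joukowski w) / w ^ Suc k) holomorphic_on ball 0 r - cball 0 1" for k
    by (intro holomorphic_intros) (auto simp: o_def)
  then have c_eq: "c s k = c ((1 + r) / 2) k" if "1 < s" "s < r" for s k
    unfolding c_def using that assms(1) by (intro contour_integral_circlepath_annulus_eq) auto
  show ?thesis
  \<comment> \<open>The midpoint of 1 and \<open>r\<close> serves as reference radius.\<close>
  proof (rule that[of "\<lambda>k. c ((1 + r) / 2) k / (2 * pi * \<i>)"])
    fix v n
    assume v: "norm (v::complex) = 1"
    define err where "err = norm (F (joukowski v) - (\<Sum>k\<le>n. c ((1 + r) / 2) k / (2 * pi * \<i>) *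
      (v ^ k + inverse v ^ k - (if k = 0 then 1 else 0))))"
    have le: "err \<le> 2 * C / (s ^ n * (s - 1))" if "s \<in> {1<..<r}" for s
      using joukowski_partial_sum_error[of s r F C v n] that assms(2) bound v c_eq[of s]
      by (simp add: err_def c_def)
    have "((\<lambda>s. 2 * C / (s ^ n * (s - 1))) \<longlongrightarrow> 2 * C / (r ^ n * (r - 1))) (at_left r)"
      using assms(1) by (intro tendsto_intros) auto
    moreover have "eventually (\<lambda>s. err \<le> 2 * C / (s ^ n * (s - 1))) (at_left r)"
      using eventually_at_left_real[OF assms(1)] by (rule eventually_mono) (rule le)
    ultimately show "err \<le> 2 * C / (r ^ n * (r - 1))"
      by (rule tendsto_lowerbound) simp
  qed
qed

section \<open>Chebyshev sums as real polynomials, and transport to a general interval\<close>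

fun chebyshev_poly :: "nat \<Rightarrow> real poly" where
  "chebyshev_poly 0 = 1"
| "chebyshev_poly (Suc 0) = [:0, 1:]"
| "chebyshev_poly (Suc (Suc k)) = [:0, 2:] * chebyshev_poly (Suc k) - chebyshev_poly k"

lemma degree_chebyshev_poly: "degree (chebyshev_poly k) \<le> k"
proof (induction k rule: chebyshev_poly.induct)
  case (3 k)
  have "degree ([:0, 2:] * chebyshev_poly (Suc k)) \<le> Suc (Suc k)"
    using degree_mult_le[of "[:0, 2:]" "chebyshev_poly (Suc k)"] 3(1) by simp
  then show ?case
    using 3 by (simp only: chebyshev_poly.simps) (intro degree_diff_le; simp)
qed auto

lemma poly_chebyshev_poly_cos: "poly (chebyshev_poly k) (cos t) = cos (real k * t)"
proof (induction k rule: chebyshev_poly.induct)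
  case (3 k)
  have "cos (real (Suc (Suc k)) * t) + cos (real k * t) = 2 * cos t * cos (real (Suc k) * t)"
    using cos_plus_cos[of "real (Suc (Suc k)) * t" "real k * t"]
    by (simp add: algebra_simps add_divide_distrib)
  then show ?case
    using 3 by simp
qed auto

text \<open>For \<open>v = cis t\<close> the point \<open>joukowski v\<close> is
  \<open>cos t\<close>, and \<open>v ^ k + inverse v ^ k\<close> is twice the Chebyshev polynomial
  at \<open>cos t\<close>. Since \<open>F\<close> is real on the segment, taking real parts keeps
  the error bound and gives a real polynomial.\<close>

lemma bernstein_poly_approx:
  fixes f :: "real \<Rightarrow> real"
  assumes "1 < r" "F holomorphic_on bernstein_ellipse r"
    and bound: "\<And>z. z \<in> bernstein_ellipse r \<Longrightarrow> norm (F z) \<le> C"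
    and f: "\<And>x. x \<in> {-1..1} \<Longrightarrow> F (of_real x) = of_real (f x)"
  obtains p where "degree p \<le> n"
    and "\<And>x. x \<in> {-1..1} \<Longrightarrow> \<bar>f x - poly p x\<bar> \<le> 2 * C / (r ^ n * (r - 1))"
proof -
  obtain a where a: "\<And>v n. norm v = 1 \<Longrightarrow>
      norm (F (joukowski v) - (\<Sum>k\<le>n. a k * (v ^ k + inverse v ^ k - (if k = 0 then 1 else 0))))
        \<le> 2 * C / (r ^ n * (r - 1))"
    using bernstein_ellipse_expansion[OF assms(1,2) bound] by blast
  \<comment> \<open>The factor 2 belongs to \<open>v ^ k + inverse v ^ k\<close>; at
    \<open>k = 0\<close> the correction reduces it to 1.\<close>
  define b where "b k = Re (a k) * (if k = 0 then 1 else 2)" for k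
  define p where "p = (\<Sum>k\<le>n. smult (b k) (chebyshev_poly k))"
  show ?thesis
  proof (rule that)
    show "degree p \<le> n"
      unfolding p_def
      by (intro degree_sum_le) (auto intro: order_trans[OF degree_smult_le] order_trans[OF degree_chebyshev_poly])
    fix x :: real
    assume x: "x \<in> {-1..1}"
    define t where "t = arccos x"
    have cos_t: "cos t = x"
      using x by (simp add: t_def)
    define v where "v = cis t"
    have power_v: "v ^ k + inverse v ^ k = of_real (2 * cos (real k * t))" for k
      by (simp add: v_def cis_inverse Complex.DeMoivre complex_eq_iff)
    have "joukowski v = of_real x"
      using power_v[of 1] by (simp add: joukowski_def cos_t)
    moreover have "Re (a k * (v ^ k + inverse v ^ k - (if k = 0 then 1 else 0))) =
        poly (smult (b k) (chebyshev_poly k)) x" for k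
      unfolding power_v by (simp add: b_def poly_chebyshev_poly_cos flip: cos_t)
    ultimately have "f x - poly p x = Re (F (joukowski v) -
        (\<Sum>k\<le>n. a k * (v ^ k + inverse v ^ k - (if k = 0 then 1 else 0))))"
      using f[OF x] by (simp add: p_def poly_sum)
    also have "\<bar>\<dots>\<bar> \<le> 2 * C / (r ^ n * (r - 1))"
      by (rule order_trans[OF abs_Re_le_cmod a]) (simp add: v_def)
    finally show "\<bar>f x - poly p x\<bar> \<le> 2 * C / (r ^ n * (r - 1))" .
  qed
qed

lemma transformed_bernstein_poly_approx:
  fixes f :: "real \<Rightarrow> real"
  assumes "L > 0" "1 < r" "F holomorphic_on transformed_bernstein_ellipse 0 L r"
    and "\<And>z. z \<in> transformed_bernstein_ellipse 0 L r \<Longrightarrow> norm (F z) \<le> C"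
    and "\<And>t. t \<in> {0..L} \<Longrightarrow> F (of_real t) = of_real (f t)"
  obtains p where "degree p \<le> n"
    and "\<And>t. t \<in> {0..L} \<Longrightarrow> \<bar>f t - poly p t\<bar> \<le> 2 * C / (r ^ n * (r - 1))"
proof -
  \<comment> \<open>The inverse of the affine map that defines the transformed ellipse.\<close>
  define \<psi> where "\<psi> z = of_real L * (z + 1) / 2" for z :: complex
  have \<psi>: "\<psi> z \<in> transformed_bernstein_ellipse 0 L r" if "z \<in> bernstein_ellipse r" for z
    using that assms(1) by (simp add: transformed_bernstein_ellipse_def \<psi>_def field_simps)
  have "\<psi> holomorphic_on bernstein_ellipse r"
    unfolding \<psi>_def[abs_def] by (intro holomorphic_intros) auto
  then have hol: "(F \<circ> \<psi>) holomorphic_on bernstein_ellipse r"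
    using \<psi> by (intro holomorphic_on_compose_gen[OF _ assms(3)]) auto
  have F\<psi>: "(F \<circ> \<psi>) (of_real x) = of_real (f (L * (x + 1) / 2))" if "x \<in> {-1..1}" for x
  proof -
    have "L * (x + 1) \<le> L * 2" "0 \<le> L * (x + 1)"
      using that assms(1) by (auto intro: mult_left_mono)
    then show ?thesis
      using assms(5)[of "L * (x + 1) / 2"] by (simp add: \<psi>_def)
  qed
  have F\<psi>_bound: "norm ((F \<circ> \<psi>) z) \<le> C" if "z \<in> bernstein_ellipse r" for z
    using assms(4)[OF \<psi>[OF that]] by simp
  obtain p where p: "degree p \<le> n"
    "\<And>x. x \<in> {-1..1} \<Longrightarrow> \<bar>f (L * (x + 1) / 2) - poly p x\<bar> \<le> 2 * C / (r ^ n * (r - 1))"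
    using bernstein_poly_approx[where n = n, OF assms(2) hol F\<psi>_bound F\<psi>] by blast
  show ?thesis
  proof (rule that[of "p \<circ>\<^sub>p [:-1, 2 / L:]"])
    show "degree (p \<circ>\<^sub>p [:-1, 2 / L:]) \<le> n"
      using p(1) assms(1) by (simp add: degree_pcompose)
    fix t
    assume "t \<in> {0..L}"
    then have "2 * t / L - 1 \<in> {-1..1}"
      using assms(1) by (auto simp: field_simps)
    from p(2)[OF this] show "\<bar>f t - poly (p \<circ>\<^sub>p [:-1, 2 / L:]) t\<bar> \<le> 2 * C / (r ^ n * (r - 1))"
      using assms(1) by (simp add: poly_pcompose algebra_simps)
  qed
qed

subsection \<open>Growth of the rank\<close>

lemma rank_bound_eq: "rank_bound n d = (n + d + 2) choose n"
  unfolding rank_bound_def by (subst binomial_symmetric) auto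

text \<open>Raising \<open>n\<close> by one multiplies the binomial coefficient by
  \<open>(n + d + 3) / (n + 1)\<close>, which is asymptotic to \<open>d / (n + 1)\<close>.\<close>

lemma rank_bound_asymp_equiv: "(\<lambda>d. real (rank_bound n d)) \<sim>[at_top] (\<lambda>d. real d ^ n / fact n)"
proof (induction n)
  case 0
  show ?case
    by (simp add: rank_bound_eq)
next
  case (Suc n)
  have "((\<lambda>d. 1 + (real n + 3) * inverse (real d)) \<longlongrightarrow> 1 + (real n + 3) * 0) at_top"
    by (intro tendsto_intros lim_inverse_n)
  moreover have "eventually (\<lambda>d. 1 + (real n + 3) * inverse (real d) =
      real (n + d + 3) / real (Suc n) / (real d / real (Suc n))) at_top"
    using eventually_gt_at_top[of 0]
  proof eventually_elim
    case (elim d)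
    then have "1 + (real n + 3) * inverse (real d) = real (n + d + 3) / real d"
      by (simp add: field_simps)
    also have "\<dots> = real (n + d + 3) / real (Suc n) / (real d / real (Suc n))"
      by (simp del: of_nat_Suc)
    finally show ?case .
  qed
  ultimately have "((\<lambda>d. real (n + d + 3) / real (Suc n) / (real d / real (Suc n))) \<longlongrightarrow> 1) at_top"
    using Lim_transform_eventually by fastforce
  then have "(\<lambda>d. real (n + d + 3) / real (Suc n)) \<sim>[at_top] (\<lambda>d. real d / real (Suc n))"
    by (rule asymp_equivI')
  then have "(\<lambda>d. real (n + d + 3) / real (Suc n) * real (rank_bound n d)) \<sim>[at_top]
      (\<lambda>d. real d / real (Suc n) * (real d ^ n / fact n))"
    by (rule asymp_equiv_mult) (rule Suc)
  moreover have "real (n + d + 3) / real (Suc n) * real (rank_bound n d) =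
      real (rank_bound (Suc n) d)" for d
  proof -
    have "Suc n * rank_bound (Suc n) d = (n + d + 3) * rank_bound n d"
      using Suc_times_binomial[of n "n + d + 2"]
      by (simp only: rank_bound_eq add_Suc) (simp add: eval_nat_numeral)
    then have "real (Suc n) * real (rank_bound (Suc n) d) = real (n + d + 3) * real (rank_bound n d)"
      by (metis of_nat_mult)
    then show ?thesis
      by (simp add: field_simps del: of_nat_Suc)
  qed
  ultimately show ?case
    by (simp add: mult.assoc)
qed

text \<open>A crude estimate, but valid for every positive \<open>d\<close>: the fixed-precision
  claim needs a bound at each dimension and not only in the limit.\<close>

lemma rank_bound_le:
  assumes "d \<ge> 1"
  shows "real (rank_bound n d) \<le> (real n + 3) ^ n * real d ^ n"
proof -
  have "rank_bound n d \<le> (n + d + 2) ^ n"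
    unfolding rank_bound_eq by (intro binomial_le_pow) auto
  also have "\<dots> \<le> ((n + 3) * d) ^ n"
  proof (rule power_mono)
    have "n \<le> n * d"
      using assms by simp
    then show "n + d + 2 \<le> (n + 3) * d"
      using assms unfolding distrib_right by linarith
  qed simp
  finally have "real (rank_bound n d) \<le> real (((n + 3) * d) ^ n)"
    by (rule of_nat_mono)
  then show ?thesis
    by (simp add: power_mult_distrib add.commute)
qed

text \<open>For \<open>s > 0\<close> the rounding error of at most 1 is negligible against a
  quantity tending to infinity. For \<open>s = 0\<close> nothing is rounded because \<open>K\<close>
  is an integer.\<close>

lemma ceiling_mult_powr_asymp_equiv:
  fixes K :: nat
  assumes "K > 0" "s \<ge> 0"
  shows "(\<lambda>d. real (nat \<lceil>real K * real d powr s\<rceil>)) \<sim>[at_top] (\<lambda>d. real K * real d powr s)"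
proof (cases "s = 0")
  case True
  have "eventually (\<lambda>d. real (nat \<lceil>real K * real d powr s\<rceil>) = real K * real d powr s) at_top"
    using eventually_gt_at_top[of 0] by eventually_elim (simp add: True)
  then show ?thesis
    by (rule asymp_equiv_refl_ev)
next
  case False
  define u where "u d = real K * real d powr s" for d
  have "((\<lambda>d. real d powr - s) \<longlongrightarrow> 0) at_top"
    using False assms by (intro tendsto_neg_powr filterlim_real_sequentially) auto
  then have "((\<lambda>d. 1 + inverse (real K) * real d powr - s) \<longlongrightarrow> 1 + inverse (real K) * 0) at_top"
    by (intro tendsto_intros)
  then have upper: "((\<lambda>d. 1 + inverse (real K) * real d powr - s) \<longlongrightarrow> 1) at_top"
    by simp
  have "((\<lambda>d. real (nat \<lceil>u d\<rceil>) / u d) \<longlongrightarrow> 1) at_top"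
  proof (rule tendsto_sandwich[OF _ _ tendsto_const upper])
    have *: "u d > 0 \<and> inverse (u d) = inverse (real K) * real d powr - s" if "d > 0" for d
      using that assms by (simp add: u_def powr_minus)
    show "eventually (\<lambda>d. 1 \<le> real (nat \<lceil>u d\<rceil>) / u d) at_top"
      using eventually_gt_at_top[of 0] by eventually_elim (use * in \<open>simp add: real_nat_ceiling_ge\<close>)
    show "eventually (\<lambda>d. real (nat \<lceil>u d\<rceil>) / u d \<le> 1 + inverse (real K) * real d powr - s) at_top"
      using eventually_gt_at_top[of 0]
    proof eventually_elim
      case (elim d)
      then have "u d > 0"
        using * by blast
      then have "real (nat \<lceil>u d\<rceil>) \<le> u d + 1"
        by linarith
      then have "real (nat \<lceil>u d\<rceil>) / u d \<le> 1 + inverse (u d)"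
        using \<open>u d > 0\<close> by (simp add: field_simps)
      then show ?case
        using * elim by simp
    qed
  qed
  then show ?thesis
    unfolding u_def by (rule asymp_equivI')
qed

section \<open>The two rank statements: fixed degree and fixed precision\<close>

lemma error_bound_eq: "error_bound C \<rho> n = 2 * C / ((\<rho>\<^sup>2) ^ n * (\<rho>\<^sup>2 - 1))"
proof -
  have "\<rho> powi (- 2 * int n) = inverse (\<rho> powi (2 * int n))"
    by (simp flip: power_int_minus)
  also have "\<rho> powi (2 * int n) = (\<rho>\<^sup>2) ^ n"
    by (simp add: power_int_mult)
  finally show ?thesis
    by (simp add: error_bound_def divide_inverse)
qed

theorem corollary2p2:
  fixes f :: "real \<Rightarrow> real" and F :: "complex \<Rightarrow> complex" and D \<rho> C :: real
  assumes "D > 0"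
    and "\<rho>\<^sup>2 > 1"
    and "\<forall>t\<in>{0..D\<^sup>2}. F (complex_of_real t) = complex_of_real (f t)"
    and "F analytic_on (complex_of_real ` {0..D\<^sup>2})"
    and "F holomorphic_on transformed_bernstein_ellipse 0 (D\<^sup>2) (\<rho>\<^sup>2)"
    and "\<forall>z \<in> transformed_bernstein_ellipse 0 (D\<^sup>2) (\<rho>\<^sup>2). norm (F z) \<le> C"
  shows "(\<exists>c1>0. \<exists>c2>0. \<forall>n \<epsilon>. \<epsilon> > 0 \<and> \<epsilon> = error_bound C \<rho> n \<longrightarrow>
            (\<forall>d\<ge>1. low_rank_approximable d (cube d D) (\<lambda>x y. f (dist_sq d x y))
                      (rank_bound n d) \<epsilon>) \<and>
            proportional_to (\<lambda>d. real (rank_bound n d))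
              (\<lambda>d. real d powr (- ln (c1 * \<epsilon>) / c2)))
       \<and> (\<exists>c1>0. \<exists>c2>0. \<forall>\<epsilon>. \<epsilon> > 0 \<and> c1 * \<epsilon> \<le> 1 \<longrightarrow>
            (\<exists>r :: nat \<Rightarrow> nat.
              (\<forall>d\<ge>1. low_rank_approximable d (cube d D) (\<lambda>x y. f (dist_sq d x y)) (r d) \<epsilon>) \<and>
              proportional_to (\<lambda>d. real (r d))
                (\<lambda>d. real d powr (- ln (c1 * \<epsilon>) / c2))))"
    (is "?fixed_degree \<and> ?fixed_precision")
proof
  define q where "q = \<rho>\<^sup>2"
  have "q > 1"
    using assms(2) by (simp add: q_def)
  then have q: "q > 1" "ln q > 0"
    by simp_all
  have approx: "low_rank_approximable d (cube d D) (\<lambda>x y. f (dist_sq d x y)) (rank_bound n d)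
      (error_bound C \<rho> n)" if "d \<ge> 1" for n d
  proof (rule transformed_bernstein_poly_approx[where L = "D\<^sup>2" and r = "\<rho>\<^sup>2" and F = F and f = f
        and C = C and n = n])
    fix p
    assume "degree p \<le> n"
      and "\<And>t. t \<in> {0..D\<^sup>2} \<Longrightarrow> \<bar>f t - poly p t\<bar> \<le> 2 * C / ((\<rho>\<^sup>2) ^ n * (\<rho>\<^sup>2 - 1))"
    then show ?thesis
      unfolding error_bound_eq using that by (rule low_rank_approximable_if_poly_approx)
  qed (use assms in auto)
  show ?fixed_degree
  proof (cases "C > 0")
    \<comment> \<open>The error bound is then not positive, so no admissible precision
      exists.\<close>
    case False
    then have "error_bound C \<rho> n \<le> 0" for n
      unfolding error_bound_eq using assms(2) by (intro divide_nonpos_nonneg) auto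
    then have "\<not> (\<epsilon> > 0 \<and> \<epsilon> = error_bound C \<rho> n)" for \<epsilon> n
      by (auto simp: not_less)
    then show ?thesis
      using zero_less_one by blast
  next
    case True
    \<comment> \<open>Normalizes the error bound to \<open>q ^ (- n)\<close>; with
      \<open>c2 = ln q\<close> the exponent is exactly \<open>n\<close>, and the factor of
      proportionality is \<open>1 / fact n\<close>.\<close>
    define c1 where "c1 = (q - 1) / (2 * C)"
    have "proportional_to (\<lambda>d. real (rank_bound n d))
        (\<lambda>d. real d powr (- ln (c1 * error_bound C \<rho> n) / ln q))" for n
      unfolding proportional_to_def
    proof (intro exI conjI)
      have "c1 * error_bound C \<rho> n = inverse (q ^ n)"
        unfolding error_bound_eq c1_def q_def[symmetric] using True q by (simp add: field_simps)
      then have exponent: "- ln (c1 * error_bound C \<rho> n) / ln q = real n"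
        using q by (simp add: ln_inverse ln_realpow)
      have "eventually (\<lambda>d. real d ^ n / fact n =
          1 / fact n * real d powr (- ln (c1 * error_bound C \<rho> n) / ln q)) at_top"
        unfolding exponent using eventually_gt_at_top[of 0]
        by eventually_elim (simp add: powr_realpow)
      then show "(\<lambda>d. real (rank_bound n d)) \<sim>[at_top]
          (\<lambda>d. 1 / fact n * real d powr (- ln (c1 * error_bound C \<rho> n) / ln q))"
        by (rule asymp_equiv_trans[OF rank_bound_asymp_equiv asymp_equiv_refl_ev])
    qed simp
    then show ?thesis
      using approx True q by (intro exI[of _ c1] conjI exI[of _ "ln q"]) (auto simp: c1_def)
  qed
  show ?fixed_precision
  proof (intro exI conjI allI impI)
    \<comment> \<open>Positive even if \<open>C = 0\<close>, so that \<open>c1\<close> is well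
      defined and positive.\<close>
    define C' where "C' = \<bar>C\<bar> + 1"
    \<comment> \<open>The extra \<open>q\<close> in the denominator pays for rounding the exponent
      \<open>s\<close> down to an integer degree.\<close>
    define c1 where "c1 = (q - 1) / (2 * C' * q)"
    have "C' > 0" "C \<le> C'"
      by (auto simp: C'_def)
    show "c1 > 0"
      using q \<open>C' > 0\<close> by (simp add: c1_def)
    show "ln q > 0"
      by (rule q)
    fix \<epsilon> :: real
    assume \<epsilon>: "\<epsilon> > 0 \<and> c1 * \<epsilon> \<le> 1"
    define s where "s = - ln (c1 * \<epsilon>) / ln q"
    \<comment> \<open>The exponent \<open>s\<close> need not be an integer. The degree is its floor,
      and the rank is afterwards enlarged from order \<open>d ^ n\<close> to order
      \<open>d powr s\<close>.\<close>
    define n where "n = nat \<lfloor>s\<rfloor>"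
    \<comment> \<open>The constant of \<open>rank_bound_le\<close>, an integer as the ceiling
      asymptotics require.\<close>
    define K where "K = (n + 3) ^ n"
    have "c1 * \<epsilon> > 0"
      using \<epsilon> \<open>c1 > 0\<close> by simp
    then have "ln (c1 * \<epsilon>) \<le> 0"
      using \<epsilon> by (subst ln_le_zero_iff) auto
    then have "s \<ge> 0"
      unfolding s_def using q by (intro divide_nonneg_pos) auto
    then have n: "real n \<le> s" "s \<le> real (Suc n)"
      unfolding n_def by linarith+
    \<comment> \<open>By the choice of \<open>s\<close>, \<open>c1 * \<epsilon>\<close> equals
      \<open>q powr (- s)\<close>, which is at least \<open>q powr (- (n + 1))\<close>.\<close>
    have "error_bound C \<rho> n \<le> \<epsilon>"
    proof -
      have "inverse (c1 * \<epsilon>) = exp (s * ln q)"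
        using q \<open>c1 * \<epsilon> > 0\<close> by (simp add: s_def exp_minus)
      also have "\<dots> = q powr s"
        using q by (simp add: powr_def)
      also have "\<dots> \<le> q powr real (Suc n)"
        using q n(2) by (intro powr_mono) auto
      also have "\<dots> = q * q ^ n"
        using q by (subst powr_realpow) auto
      finally have "1 \<le> c1 * \<epsilon> * (q * q ^ n)"
        using \<open>c1 * \<epsilon> > 0\<close> by (simp add: field_simps)
      also have "\<dots> = \<epsilon> * (q ^ n * (q - 1)) / (2 * C')"
        using q by (simp add: c1_def)
      finally have "2 * C' \<le> \<epsilon> * (q ^ n * (q - 1))"
        using \<open>C' > 0\<close> by (simp add: field_simps)
      then have "2 * C \<le> \<epsilon> * (q ^ n * (q - 1))"
        using \<open>C \<le> C'\<close> by linarith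
      then show ?thesis
        unfolding error_bound_eq q_def[symmetric] using q by (simp add: pos_divide_le_eq)
    qed
    have rank_le: "rank_bound n d \<le> nat \<lceil>real K * real d powr s\<rceil>" if "d \<ge> 1" for d
    proof -
      have "real (rank_bound n d) \<le> real K * real d powr real n"
        using rank_bound_le[OF that, of n] that by (simp add: K_def powr_realpow)
      also have "\<dots> \<le> real K * real d powr s"
        using that n(1) by (intro mult_left_mono powr_mono) auto
      also have "\<dots> \<le> real (nat \<lceil>real K * real d powr s\<rceil>)"
        by (rule real_nat_ceiling_ge)
      finally show ?thesis
        by simp
    qed
    show "low_rank_approximable d (cube d D) (\<lambda>x y. f (dist_sq d x y))
        (nat \<lceil>real K * real d powr s\<rceil>) \<epsilon>" if "d \<ge> 1" for d
      using approx[OF that] rank_le[OF that] \<open>error_bound C \<rho> n \<le> \<epsilon>\<close>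
      by (rule low_rank_approximable_mono)
    show "proportional_to (\<lambda>d. real (nat \<lceil>real K * real d powr s\<rceil>))
        (\<lambda>d. real d powr (- ln (c1 * \<epsilon>) / ln q))"
      unfolding proportional_to_def s_def[symmetric]
      using ceiling_mult_powr_asymp_equiv[of K s] \<open>s \<ge> 0\<close>
      by (intro exI[of _ "real K"]) (auto simp: K_def)
  qed
qed

end
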